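(* Let $\Omega$ be an infinite set, $\{K_\theta\}_{\theta\in\Theta}$ a family of symmetric positive-definite kernels on $\Omega$, and $\{x_i\}_{i=1}^\infty$ a sequence of pairwise distinct points in $\Omega$. Let $\Delta\subset\Theta$ and $\theta_0\in\Theta$, and suppose that $B$ is a bounded subset of $H(K_{\theta_0})$. (1) If $$\limsup_{n\to\infty}\,\sup_{\theta\in\Delta}\frac{\mathbb V_{\theta_0}(x_n\mid X_{n-1})}{\mathbb V_\theta(x_n\mid X_{n-1})}<1,$$ then $\hat\theta_{\mathrm{ML}}^{f_0}(X_n)\notin\Delta$ for every $f_0\in B$ when $n$ is sufficiently large; that is, there is $N\in\mathbb{N}$ such that $\hat\theta_{\mathrm{ML}}^{f_0}(X_n)\notin\Delta$ for every $f_0\in B$ and every $n\ge N$. (2) Let $b=\sup_{f_0\in B}\|f_0\|_{\theta_0}$. If $$\limsup_{n\to\infty}\,\sup_{\theta\in\Delta}\max_{1\le i\le n}\frac{\mathbb V_{\theta_0}(x_i\mid X_n^i)}{\mathbb V_\theta(x_i\mid X_n^i)}<\exp(-b^2),$$ then $\hat\theta_{\mathrm{CV}}^{f_0}(X_n)\notin\Delta$ for every $f_0\in B$ when $n$ is sufficiently large; that is, there is $N\in\mathbb{N}$ such that $\hat\theta_{\mathrm{CV}}^{f_0}(X_n)\notin\Delta$ for every $f_0\in B$ and every $n\ge N$.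
   Context: A kernel $K_\theta:\Omega\times\Omega\to\mathbb{R}$ is symmetric and positive-definite in the strict sense: $\sum_{i,j=1}^na_ia_jK_\theta(x_i,x_j)>0$ for all $n\in\mathbb{N}$, pairwise distinct $x_1,\dots,x_n\in\Omega$ and non-zero $(a_1,\dots,a_n)\in\mathbb{R}^n$. $H(K_\theta)$ is its reproducing kernel Hilbert space with norm $\|\cdot\|_\theta$. Notation: $X_n=\{x_i\}_{i=1}^n$, $X_0=\emptyset$, $X_n^i=X_n\setminus\{x_i\}$. For a finite set $X$ of distinct points, $f_0(X)$ is the column vector of values of $f_0$ at the points of $X$, $K_\theta(X)$ is the matrix with entries $K_\theta(x_i,x_j)$, and $K_\theta(x,X)$ the column vector with entries $K_\theta(x,x_i)$. The conditional mean and variance are $$\mu_{\theta,f_0}(x\mid X)=K_\theta(x,X)^{\mathsf T}K_\theta(X)^{-1}f_0(X),\qquad \mathbb V_\theta(x\mid X)=K_\theta(x,x)-K_\theta(x,X)^{\mathsf T}K_\theta(X)^{-1}K_\theta(x,X),$$ with $\mu_{\theta,f_0}(x\mid\emptyset)=0$ and $\mathbb V_\theta(x\mid\emptyset)=K_\theta(x,x)$. Estimators: for $f_0:\Omega\to\mathbb{R}$, the maximum likelihood estimate $\hat\theta_{\mathrm{ML}}^{f_0}(X_n)$ is any minimiser over $\theta\in\Theta$ of $$\ell_{\mathrm{ML}}^{f_0}(\theta\mid X_n)=f_0(X_n)^{\mathsf T}K_\theta(X_n)^{-1}f_0(X_n)+\log\det K_\theta(X_n),$$ and the leave-one-out cross-validated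 estimate $\hat\theta_{\mathrm{CV}}^{f_0}(X_n)$ is any minimiser over $\theta\in\Theta$ of $$\ell_{\mathrm{CV}}^{f_0}(\theta\mid X_n)=\sum_{i=1}^n\Big[\frac{(f_0(x_i)-\mu_{\theta,f_0}(x_i\mid X_n^i))^2}{\mathbb V_\theta(x_i\mid X_n^i)}+\log\mathbb V_\theta(x_i\mid X_n^i)\Big].$$
   Formalization: In (1), the N uniform over B is proved if all suprema over Δ (n ≥ 1) are finite or an ML estimate exists for every f_0 and n; otherwise N may depend on f_0. As written, with an infinite supremum at some n allowed, uniformity is false (diagonal-kernel counterexample). *)

theory Defs
  imports
    Complex_Main
    "HOL-Library.Extended_Real"
    "HOL-Library.Liminf_Limsup"
    "Jordan_Normal_Form.Determinant"
    "Jordan_Normal_Form.Gauss_Jordan_Elimination"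
begin

definition pd_kernel :: "'a set \<Rightarrow> ('a \<Rightarrow> 'a \<Rightarrow> real) \<Rightarrow> bool" where
  "pd_kernel \<Omega> k \<longleftrightarrow>
     (\<forall>x\<in>\<Omega>. \<forall>y\<in>\<Omega>. k x y = k y x) \<and>
     (\<forall>(n::nat) (z :: nat \<Rightarrow> 'a) (a :: nat \<Rightarrow> real).
        z ` {1..n} \<subseteq> \<Omega> \<and> inj_on z {1..n} \<and> (\<exists>i\<in>{1..n}. a i \<noteq> 0) \<longrightarrow>
        0 < (\<Sum>i=1..n. \<Sum>j=1..n. a i * a j * k (z i) (z j)))"

text \<open>
  A real function on \<open>\<Omega>\<close> is represented by its extension by zero to the whole type.
  This makes the representation unique and keeps it stable under pointwise operations.
\<close>

definition kernel_section :: "'a set \<Rightarrow> ('a \<Rightarrow> 'a \<Rightarrow> real) \<Rightarrow> 'a \<Rightarrow> 'a \<Rightarrow> real" where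
  "kernel_section \<Omega> k x = (\<lambda>y. if y \<in> \<Omega> then k x y else 0)"

definition rkhs_norm :: "(('a \<Rightarrow> real) \<Rightarrow> ('a \<Rightarrow> real) \<Rightarrow> real) \<Rightarrow> ('a \<Rightarrow> real) \<Rightarrow> real" where
  "rkhs_norm ip f = sqrt (ip f f)"

text \<open>
  \<open>rkhs \<Omega> k H ip\<close> states that \<open>H\<close> with inner product \<open>ip\<close> is the reproducing kernel Hilbert
  space of \<open>k\<close>: a Hilbert space of functions on \<open>\<Omega>\<close> that contains the kernel sections and
  has the reproducing property. By the Moore--Aronszajn theorem such a pair exists and, up to the
  values of \<open>ip\<close> outside \<open>H\<close>, is unique.
\<close>

locale rkhs =
  fixes \<Omega> :: "'a set"
    and k :: "'a \<Rightarrow> 'a \<Rightarrow> real"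
    and H :: "('a \<Rightarrow> real) set"
    and ip :: "('a \<Rightarrow> real) \<Rightarrow> ('a \<Rightarrow> real) \<Rightarrow> real"
  assumes supported: "\<And>f x. f \<in> H \<Longrightarrow> x \<notin> \<Omega> \<Longrightarrow> f x = 0"
    and zero_mem: "(\<lambda>x. 0) \<in> H"
    and add_mem: "\<And>f g. f \<in> H \<Longrightarrow> g \<in> H \<Longrightarrow> (\<lambda>x. f x + g x) \<in> H"
    and scale_mem: "\<And>c f. f \<in> H \<Longrightarrow> (\<lambda>x. c * f x) \<in> H"
    and ip_commute: "\<And>f g. f \<in> H \<Longrightarrow> g \<in> H \<Longrightarrow> ip f g = ip g f"
    and ip_add_left: "\<And>f g h. f \<in> H \<Longrightarrow> g \<in> H \<Longrightarrow> h \<in> H \<Longrightarrow>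
           ip (\<lambda>x. f x + g x) h = ip f h + ip g h"
    and ip_scale_left: "\<And>c f g. f \<in> H \<Longrightarrow> g \<in> H \<Longrightarrow> ip (\<lambda>x. c * f x) g = c * ip f g"
    and ip_nonneg: "\<And>f. f \<in> H \<Longrightarrow> 0 \<le> ip f f"
    and ip_definite: "\<And>f. f \<in> H \<Longrightarrow> ip f f = 0 \<Longrightarrow> f = (\<lambda>x. 0)"
    and complete: "\<And>g :: nat \<Rightarrow> 'a \<Rightarrow> real. (\<And>n. g n \<in> H) \<Longrightarrow>
           (\<And>e. 0 < e \<Longrightarrow> \<exists>N. \<forall>m\<ge>N. \<forall>n\<ge>N. rkhs_norm ip (\<lambda>x. g m x - g n x) < e) \<Longrightarrow>
           \<exists>f\<in>H. (\<lambda>n. rkhs_norm ip (\<lambda>x. g n x - f x)) \<longlonglongrightarrow> 0"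
    and section_mem: "\<And>x. x \<in> \<Omega> \<Longrightarrow> kernel_section \<Omega> k x \<in> H"
    and reproducing: "\<And>f x. f \<in> H \<Longrightarrow> x \<in> \<Omega> \<Longrightarrow> ip f (kernel_section \<Omega> k x) = f x"

definition rkhs_bounded :: "(('a \<Rightarrow> real) \<Rightarrow> ('a \<Rightarrow> real) \<Rightarrow> real) \<Rightarrow> ('a \<Rightarrow> real) set \<Rightarrow> bool" where
  "rkhs_bounded ip B \<longleftrightarrow> (\<exists>C. \<forall>f\<in>B. rkhs_norm ip f \<le> C)"

text \<open>
  A finite set of points is represented by a distinct list enumerating it; conditional mean,
  conditional variance and likelihood do not depend on the chosen order. Gram matrices of distinct
  points are invertible, so that \<^const>\<open>mat_inverse\<close> returns a value on them.
\<close>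

definition gram_mat :: "('a \<Rightarrow> 'a \<Rightarrow> real) \<Rightarrow> 'a list \<Rightarrow> real mat" where
  "gram_mat k X = mat (length X) (length X) (\<lambda>(i, j). k (X ! i) (X ! j))"

definition gram_inv :: "('a \<Rightarrow> 'a \<Rightarrow> real) \<Rightarrow> 'a list \<Rightarrow> real mat" where
  "gram_inv k X = the (mat_inverse (gram_mat k X))"

definition cond_mean :: "('a \<Rightarrow> 'a \<Rightarrow> real) \<Rightarrow> ('a \<Rightarrow> real) \<Rightarrow> 'a \<Rightarrow> 'a list \<Rightarrow> real" where
  "cond_mean k f x X = vec_of_list (map (k x) X) \<bullet> (gram_inv k X *\<^sub>v vec_of_list (map f X))"

definition cond_var :: "('a \<Rightarrow> 'a \<Rightarrow> real) \<Rightarrow> 'a \<Rightarrow> 'a list \<Rightarrow> real" where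
  "cond_var k x X =
     k x x - vec_of_list (map (k x) X) \<bullet> (gram_inv k X *\<^sub>v vec_of_list (map (k x) X))"

lemma gram_inv_Nil: "gram_inv k [] \<in> carrier_mat 0 0"
proof -
  have A: "gram_mat k [] \<in> carrier_mat 0 0"
    by (simp add: gram_mat_def)
  have "gram_mat k [] \<in> Units (ring_mat TYPE(real) 0 ())"
    using A by (auto simp: Units_def ring_mat_def intro!: bexI[OF _ A] eq_matI)
  then obtain C where "mat_inverse (gram_mat k []) = Some C"
    using mat_inverse(1)[OF A, where b = "()"] by (cases "mat_inverse (gram_mat k [])") auto
  then show ?thesis
    using mat_inverse(2)[OF A] by (auto simp: gram_inv_def)
qed

lemma cond_mean_Nil: "cond_mean k f x [] = 0"
  and cond_var_Nil: "cond_var k x [] = k x x"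
  using gram_inv_Nil[of k] by (auto simp: cond_mean_def cond_var_def scalar_prod_def)

definition points :: "(nat \<Rightarrow> 'a) \<Rightarrow> nat \<Rightarrow> 'a list" where
  "points x n = map x [1..<Suc n]"

definition points_without :: "(nat \<Rightarrow> 'a) \<Rightarrow> nat \<Rightarrow> nat \<Rightarrow> 'a list" where
  "points_without x n i = removeAll (x i) (points x n)"

definition ml_loss :: "('a \<Rightarrow> 'a \<Rightarrow> real) \<Rightarrow> ('a \<Rightarrow> real) \<Rightarrow> (nat \<Rightarrow> 'a) \<Rightarrow> nat \<Rightarrow> real" where
  "ml_loss k f x n =
     vec_of_list (map f (points x n)) \<bullet>
       (gram_inv k (points x n) *\<^sub>v vec_of_list (map f (points x n)))
     + ln (det (gram_mat k (points x n)))"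

definition cv_loss :: "('a \<Rightarrow> 'a \<Rightarrow> real) \<Rightarrow> ('a \<Rightarrow> real) \<Rightarrow> (nat \<Rightarrow> 'a) \<Rightarrow> nat \<Rightarrow> real" where
  "cv_loss k f x n =
     (\<Sum>i=1..n. (f (x i) - cond_mean k f (x i) (points_without x n i))\<^sup>2
                  / cond_var k (x i) (points_without x n i)
                + ln (cond_var k (x i) (points_without x n i)))"

definition ml_estimate ::
  "'t set \<Rightarrow> ('t \<Rightarrow> 'a \<Rightarrow> 'a \<Rightarrow> real) \<Rightarrow> ('a \<Rightarrow> real) \<Rightarrow> (nat \<Rightarrow> 'a) \<Rightarrow> nat \<Rightarrow> 't \<Rightarrow> bool" where
  "ml_estimate \<Theta> K f x n \<theta> \<longleftrightarrow> is_arg_min (\<lambda>\<theta>. ml_loss (K \<theta>) f x n) (\<lambda>\<theta>. \<theta> \<in> \<Theta>) \<theta>"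

definition cv_estimate ::
  "'t set \<Rightarrow> ('t \<Rightarrow> 'a \<Rightarrow> 'a \<Rightarrow> real) \<Rightarrow> ('a \<Rightarrow> real) \<Rightarrow> (nat \<Rightarrow> 'a) \<Rightarrow> nat \<Rightarrow> 't \<Rightarrow> bool" where
  "cv_estimate \<Theta> K f x n \<theta> \<longleftrightarrow> is_arg_min (\<lambda>\<theta>. cv_loss (K \<theta>) f x n) (\<lambda>\<theta>. \<theta> \<in> \<Theta>) \<theta>"

text \<open>
  \<open>ml_well_posed\<close> makes explicit what the maximum likelihood claim presupposes in order to hold
  uniformly over a bounded set of functions: either the suprema of the variance ratios are real
  numbers (a limit superior only sees all but finitely many of them), or an estimate exists
  for all data. Without it uniformity fails. On \<open>\<Omega> = {x\<^sub>1, x\<^sub>2, \<dots>}\<close> take diagonal kernels, with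
  \<open>K\<^sub>0\<close> the identity and, for \<open>j \<ge> 1\<close>, \<open>K\<^sub>j(x\<^sub>1, x\<^sub>1) = exp (-j)\<close> and \<open>K\<^sub>j(x\<^sub>i, x\<^sub>i) = exp 1\<close> for
  \<open>i \<ge> 2\<close>. With \<open>\<theta>\<^sub>0 = 0\<close> and \<open>\<Delta> = {1, 2, \<dots>}\<close> the ratios are \<open>exp (-1)\<close> for \<open>n \<ge> 2\<close>, but for the
  function \<open>f\<close> that is \<open>exp (-n)\<close> at \<open>x\<^sub>1\<close> and zero elsewhere, the likelihood loss at
  \<open>X\<^sub>n\<close> is \<open>exp (j - 2 n) - j + n - 1\<close> for \<open>j \<ge> 1\<close> and \<open>exp (-2 n)\<close> for \<open>j = 0\<close>, whose unique
  minimiser is \<open>j = 2 n\<close>. These functions form a bounded set.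
\<close>

definition ml_well_posed ::
  "'t set \<Rightarrow> 't set \<Rightarrow> 't \<Rightarrow> ('t \<Rightarrow> 'a \<Rightarrow> 'a \<Rightarrow> real) \<Rightarrow> (nat \<Rightarrow> 'a) \<Rightarrow> bool" where
  "ml_well_posed \<Theta> \<Delta> \<theta>0 K x \<longleftrightarrow>
     (\<forall>n\<ge>1. (SUP \<theta>\<in>\<Delta>. ereal (cond_var (K \<theta>0) (x n) (points x (n - 1))
                               / cond_var (K \<theta>) (x n) (points x (n - 1)))) < \<infinity>) \<or>
     (\<forall>f. \<forall>n\<ge>1. \<exists>\<theta>. ml_estimate \<Theta> K f x n \<theta>)"

end

theory Submission
  imports Defs
begin

text \<open>
  Both parts compare the loss at \<open>\<theta>\<close> with the loss at \<open>\<theta>0\<close>. The fit term \<open>f\<^sup>T K\<^sup>-\<^sup>1 f\<close> is the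
  maximum over weights \<open>w\<close> of \<open>2 w\<^sup>T f - w\<^sup>T K w\<close>; hence it grows with the set of points, and since this
  expression equals \<open>\<parallel>f\<parallel>\<^sup>2 - \<parallel>f - \<Sum> w\<^sub>i K(x\<^sub>i, \<cdot>)\<parallel>\<^sup>2\<close> in the reproducing kernel Hilbert space, it is at
  most \<open>\<parallel>f\<parallel>\<^sup>2\<close>. Weights that represent a prediction residual give in the same way that the squared
  residual is at most \<open>\<parallel>f\<parallel>\<^sup>2\<close> times the conditional variance. For cross-validation this settles the
  comparison summand by summand. For maximum likelihood the log determinant is the sum of the logarithms
  of the sequential variances, so the loss at \<open>\<theta> \<in> \<Delta>\<close> gains linearly over that at \<open>\<theta>0\<close>, once it is
  bounded below at some starting index. If infinitely many estimates exist for \<open>f\<close>, the minimal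
  value at one of them is such a bound for that \<open>f\<close>; well-posedness gives one for all \<open>f\<close>,
  either from the finite variance ratios or from an estimate for the zero function, whose loss is
  the log determinant alone.
\<close>

section \<open>Quadratic forms of a kernel on a list of points\<close>

text \<open>Weights are functions on \<open>nat\<close> and only their values below
  \<open>length X\<close> count, so the same weights can be used on \<open>X\<close> and on an
  extension of \<open>X\<close>.\<close>

definition quad_form :: "('a \<Rightarrow> 'a \<Rightarrow> real) \<Rightarrow> 'a list \<Rightarrow> (nat \<Rightarrow> real) \<Rightarrow> real" where
  "quad_form k X w = (\<Sum>i<length X. \<Sum>j<length X. w i * w j * k (X ! i) (X ! j))"

definition data_fit :: "('a \<Rightarrow> 'a \<Rightarrow> real) \<Rightarrow> ('a \<Rightarrow> real) \<Rightarrow> 'a list \<Rightarrow> real" where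
  "data_fit k f X = vec_of_list (map f X) \<bullet> (gram_inv k X *\<^sub>v vec_of_list (map f X))"

lemma quad_form_cong:
  "(\<And>i. i < length X \<Longrightarrow> v i = w i) \<Longrightarrow> quad_form k X v = quad_form k X w"
  by (simp add: quad_form_def)

text \<open>The two mixed sums agree by symmetry. They are grouped as \<open>w\<close> against the
  Gram matrix times \<open>v\<close>, which becomes \<open>w\<close> against the data once
  \<open>v\<close> solves the interpolation equations.\<close>

lemma quad_form_diff:
  assumes "\<And>y z. y \<in> set X \<Longrightarrow> z \<in> set X \<Longrightarrow> k y z = k z y"
  shows "quad_form k X (\<lambda>i. v i - w i) =
    quad_form k X v + quad_form k X w
      - 2 * (\<Sum>i<length X. w i * (\<Sum>j<length X. k (X ! i) (X ! j) * v j))"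
proof -
  have "(\<Sum>i<length X. \<Sum>j<length X. v i * w j * k (X ! i) (X ! j)) =
        (\<Sum>i<length X. \<Sum>j<length X. w i * v j * k (X ! i) (X ! j))"
    by (subst sum.swap) (auto intro!: sum.cong simp: assms)
  then show ?thesis
    by (simp add: quad_form_def sum_distrib_left algebra_simps sum.distrib sum_subtractf)
qed

lemma quad_form_append:
  assumes "\<And>z. z \<in> set X \<Longrightarrow> k y z = k z y"
  shows "quad_form k (X @ [y]) w =
    quad_form k X w + 2 * w (length X) * (\<Sum>i<length X. w i * k y (X ! i))
      + (w (length X))\<^sup>2 * k y y"
proof -
  have "(\<Sum>i<length X. w i * w (length X) * k (X ! i) y) =
        w (length X) * (\<Sum>i<length X. w i * k y (X ! i))"
    by (auto intro!: sum.cong simp: assms sum_distrib_left)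
  moreover have "(\<Sum>i<length X. w (length X) * w i * k y (X ! i)) =
        w (length X) * (\<Sum>i<length X. w i * k y (X ! i))"
    by (auto intro!: sum.cong simp: sum_distrib_left)
  ultimately show ?thesis
    by (simp add: quad_form_def nth_append sum.distrib power2_eq_square)
qed

subsection \<open>Gram matrices\<close>

locale pd_points =
  fixes \<Omega> :: "'a set" and k :: "'a \<Rightarrow> 'a \<Rightarrow> real" and X :: "'a list"
  assumes pd: "pd_kernel \<Omega> k" and subset: "set X \<subseteq> \<Omega>" and distinct: "distinct X"
begin

lemma sym: "y \<in> \<Omega> \<Longrightarrow> z \<in> \<Omega> \<Longrightarrow> k y z = k z y"
  using pd by (simp add: pd_kernel_def)

lemma nth_in [simp]: "i < length X \<Longrightarrow> X ! i \<in> \<Omega>"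
  using subset nth_mem by blast

lemma quad_form_pos:
  assumes "i < length X" "w i \<noteq> 0"
  shows "0 < quad_form k X w"
proof -
  \<comment> \<open>List positions start at 0, the sums in \<open>pd_kernel\<close> at 1.\<close>
  have bij: "bij_betw (\<lambda>i. i - 1) {1..length X} {..<length X}"
    by (rule bij_betw_byWitness[where f' = Suc]) auto
  let ?z = "\<lambda>i. X ! (i - 1)" and ?a = "\<lambda>i. w (i - 1)"
  have "?z ` {1..length X} \<subseteq> \<Omega>"
    by auto
  moreover have "inj_on ?z {1..length X}"
    using distinct by (auto simp: inj_on_def nth_eq_iff_index_eq)
  moreover have "\<exists>i\<in>{1..length X}. ?a i \<noteq> 0"
    using assms by (intro bexI[of _ "Suc i"]) auto
  ultimately have "0 < (\<Sum>i=1..length X. \<Sum>j=1..length X. ?a i * ?a j * k (?z i) (?z j))"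
    using pd unfolding pd_kernel_def
    by (elim conjE allE[of _ "length X"] allE[of _ ?z] allE[of _ ?a]) simp
  also have "\<dots> = quad_form k X w"
    unfolding quad_form_def
    by (subst sum.reindex_bij_betw[OF bij, symmetric], rule sum.cong[OF refl],
        subst sum.reindex_bij_betw[OF bij, symmetric]) simp
  finally show ?thesis .
qed

lemma quad_form_nonneg: "0 \<le> quad_form k X w"
proof (cases "\<exists>i<length X. w i \<noteq> 0")
  case False
  then show ?thesis by (simp add: quad_form_def)
qed (use quad_form_pos in \<open>auto intro: less_imp_le\<close>)

lemma gram_carrier: "gram_mat k X \<in> carrier_mat (length X) (length X)"
  by (simp add: gram_mat_def)

lemma scalar_gram:
  assumes "v \<in> carrier_vec (length X)"
  shows "v \<bullet> (gram_mat k X *\<^sub>v v) = quad_form k X (\<lambda>i. v $ i)"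
  using assms
  by (auto simp: scalar_prod_def gram_mat_def quad_form_def sum_distrib_left lessThan_atLeast0
      algebra_simps intro!: sum.cong)

text \<open>A nonzero null vector would give the quadratic form the value zero, against strict
  positivity.\<close>

lemma det_gram_nonzero: "det (gram_mat k X) \<noteq> 0"
proof
  assume "det (gram_mat k X) = 0"
  then obtain v where v: "v \<in> carrier_vec (length X)" "v \<noteq> 0\<^sub>v (length X)"
    "gram_mat k X *\<^sub>v v = 0\<^sub>v (length X)"
    using det_0_iff_vec_prod_zero_field[OF gram_carrier] by auto
  then obtain i where "i < length X" "v $ i \<noteq> 0"
    by (auto simp: vec_eq_iff)
  then show False
    using quad_form_pos[of i "\<lambda>i. v $ i"] scalar_gram[of v] v by simp
qed

lemma gram_inverse:
  shows gram_inv_carrier: "gram_inv k X \<in> carrier_mat (length X) (length X)"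
    and gram_mult_inv: "gram_mat k X * gram_inv k X = 1\<^sub>m (length X)"
proof -
  have "gram_mat k X \<in> Units (ring_mat TYPE(real) (length X) ())"
    using det_non_zero_imp_unit[OF gram_carrier det_gram_nonzero] .
  then obtain C where "mat_inverse (gram_mat k X) = Some C"
    using mat_inverse(1)[OF gram_carrier, where b = "()"]
    by (cases "mat_inverse (gram_mat k X)") auto
  then show "gram_inv k X \<in> carrier_mat (length X) (length X)"
    and "gram_mat k X * gram_inv k X = 1\<^sub>m (length X)"
    using mat_inverse(2)[OF gram_carrier] by (auto simp: gram_inv_def)
qed

text \<open>For \<open>f\<close> these are the coefficients of its kernel interpolant on
  \<open>X\<close>; for \<open>k y\<close> they are the kriging weights that predict the value at
  \<open>y\<close>.\<close>

definition coeffs :: "('a \<Rightarrow> real) \<Rightarrow> nat \<Rightarrow> real" where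
  "coeffs f i = (gram_inv k X *\<^sub>v vec_of_list (map f X)) $ i"

text \<open>The interpolation equations. Together with \<open>scalar_gram_inv\<close> they replace
  the inverse matrix in the later computations.\<close>

lemma gram_mult_coeffs:
  assumes "i < length X"
  shows "(\<Sum>j<length X. k (X ! i) (X ! j) * coeffs f j) = f (X ! i)"
proof -
  let ?f = "vec_of_list (map f X)"
  have f: "?f \<in> carrier_vec (length X)" by (simp add: carrier_vecI)
  have "gram_mat k X *\<^sub>v (gram_inv k X *\<^sub>v ?f) = ?f"
    using assoc_mult_mat_vec[OF gram_carrier gram_inv_carrier f] gram_mult_inv f by simp
  then have "(gram_mat k X *\<^sub>v (gram_inv k X *\<^sub>v ?f)) $ i = f (X ! i)"
    using assms by (simp add: vec_of_list_index)
  moreover have "(gram_mat k X *\<^sub>v (gram_inv k X *\<^sub>v ?f)) $ i =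
      (\<Sum>j<length X. k (X ! i) (X ! j) * coeffs f j)"
    using assms gram_inv_carrier
    by (simp add: coeffs_def gram_mat_def scalar_prod_def lessThan_atLeast0)
  ultimately show ?thesis by simp
qed

lemma scalar_gram_inv:
  "vec_of_list (map g X) \<bullet> (gram_inv k X *\<^sub>v vec_of_list (map f X)) =
    (\<Sum>i<length X. g (X ! i) * coeffs f i)"
  using gram_inv_carrier
  by (simp add: scalar_prod_def coeffs_def lessThan_atLeast0 vec_of_list_index)

lemma quad_form_coeffs:
  "quad_form k X (coeffs f) = (\<Sum>i<length X. coeffs f i * f (X ! i))"
proof -
  have "quad_form k X (coeffs f) =
    (\<Sum>i<length X. coeffs f i * (\<Sum>j<length X. k (X ! i) (X ! j) * coeffs f j))"
    by (simp add: quad_form_def sum_distrib_left algebra_simps)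
  then show ?thesis by (simp add: gram_mult_coeffs)
qed

lemma data_fit_eq: "data_fit k f X = (\<Sum>i<length X. coeffs f i * f (X ! i))"
  unfolding data_fit_def scalar_gram_inv by (simp add: mult.commute)

text \<open>Completing the square: the gap between the two sides is the quadratic form at
  \<open>coeffs f - w\<close>.\<close>

lemma data_fit_ge:
  "2 * (\<Sum>i<length X. w i * f (X ! i)) - quad_form k X w \<le> data_fit k f X"
proof -
  have "0 \<le> quad_form k X (\<lambda>i. coeffs f i - w i)" by (rule quad_form_nonneg)
  also have "\<dots> = data_fit k f X + quad_form k X w - 2 * (\<Sum>i<length X. w i * f (X ! i))"
    using subset
    by (subst quad_form_diff) (auto intro: sym simp: gram_mult_coeffs quad_form_coeffs data_fit_eq)
  finally show ?thesis by simp
qed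

lemma data_fit_nonneg: "0 \<le> data_fit k f X"
  using data_fit_ge[of "\<lambda>_. 0" f] by (simp add: quad_form_def)

lemma data_fit_zero: "data_fit k (\<lambda>_. 0) X = 0"
  by (simp add: data_fit_eq)

lemma cond_var_eq: "cond_var k y X = k y y - (\<Sum>i<length X. k y (X ! i) * coeffs (k y) i)"
  unfolding cond_var_def scalar_gram_inv ..

text \<open>Symmetry moves the inverse from the data to the kernel vector, so the prediction is a
  combination of the data with weights that do not depend on \<open>f\<close>.\<close>

lemma cond_mean_eq:
  assumes "y \<in> \<Omega>"
  shows "cond_mean k f y X = (\<Sum>i<length X. coeffs (k y) i * f (X ! i))"
proof -
  have "cond_mean k f y X = (\<Sum>i<length X. k y (X ! i) * coeffs f i)"
    unfolding cond_mean_def scalar_gram_inv ..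
  also have "\<dots> = (\<Sum>i<length X. \<Sum>j<length X. k (X ! i) (X ! j) * coeffs (k y) j * coeffs f i)"
    by (simp add: gram_mult_coeffs flip: sum_distrib_right)
  also have "\<dots> = (\<Sum>i<length X. \<Sum>j<length X. k (X ! i) (X ! j) * coeffs f j * coeffs (k y) i)"
    using subset by (subst sum.swap) (auto intro!: sum.cong sym)
  also have "\<dots> = (\<Sum>i<length X. coeffs (k y) i * f (X ! i))"
    by (simp add: gram_mult_coeffs flip: sum_distrib_right) (simp add: mult.commute)
  finally show ?thesis .
qed

text \<open>These weights on \<open>X\<close> followed by \<open>y\<close> represent
  \<open>t\<close> times the prediction residual at \<open>y\<close>. The scale \<open>t\<close> is
  left free for a later optimisation.\<close>

definition residual_weights :: "'a \<Rightarrow> real \<Rightarrow> nat \<Rightarrow> real" where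
  "residual_weights y t i = (if i < length X then - t * coeffs (k y) i else t)"

text \<open>Splitting off \<open>y\<close> gives three terms; by the interpolation equations the
  form on \<open>X\<close> cancels half of the mixed term, which leaves the Schur
  complement.\<close>

lemma quad_form_residual:
  assumes "y \<in> \<Omega>"
  shows "quad_form k (X @ [y]) (residual_weights y t) = t\<^sup>2 * cond_var k y X"
proof -
  have "quad_form k X (residual_weights y t) = t\<^sup>2 * quad_form k X (coeffs (k y))"
    by (simp add: quad_form_def residual_weights_def sum_distrib_left power2_eq_square algebra_simps)
  moreover have "2 * t * (\<Sum>i<length X. residual_weights y t i * k y (X ! i)) =
      - 2 * t\<^sup>2 * (\<Sum>i<length X. coeffs (k y) i * k y (X ! i))"
    by (simp add: residual_weights_def sum_distrib_left power2_eq_square sum_negf algebra_simps)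
  moreover have "quad_form k (X @ [y]) (residual_weights y t) = quad_form k X (residual_weights y t)
      + 2 * t * (\<Sum>i<length X. residual_weights y t i * k y (X ! i)) + t\<^sup>2 * k y y"
    using assms subset by (subst quad_form_append) (auto intro: sym simp: residual_weights_def)
  ultimately show ?thesis
    by (simp add: quad_form_coeffs cond_var_eq algebra_simps)
qed

lemma sum_residual:
  assumes "y \<in> \<Omega>"
  shows "(\<Sum>i<length (X @ [y]). residual_weights y t i * f ((X @ [y]) ! i)) =
    t * (f y - cond_mean k f y X)"
  using assms
  by (simp add: nth_append residual_weights_def cond_mean_eq sum_distrib_left algebra_simps sum_negf)

end

section \<open>Adding one point\<close>

locale pd_points_extend = pd_points +
  fixes y :: 'a
  assumes y: "y \<in> \<Omega>" "y \<notin> set X"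
begin

sublocale ext: pd_points \<Omega> k "X @ [y]"
  using pd subset distinct y by unfold_locales auto

text \<open>The variance is the quadratic form of the residual weights for \<open>t = 1\<close>,
  whose last entry is 1 and hence nonzero.\<close>

lemma cond_var_pos: "0 < cond_var k y X"
  using ext.quad_form_pos[of "length X" "residual_weights y 1"] y(1)
  by (simp add: quad_form_residual) (simp add: residual_weights_def)

text \<open>The optimal weights on \<open>X\<close>, extended by zero at \<open>y\<close>, compete
  in the maximum over the longer list.\<close>

lemma data_fit_mono: "data_fit k f X \<le> data_fit k f (X @ [y])"
proof -
  define w where "w i = (if i < length X then coeffs f i else 0)" for i
  have "quad_form k (X @ [y]) w = quad_form k X w"
    using subset y by (subst quad_form_append) (auto intro: sym simp: w_def)
  also have "\<dots> = data_fit k f X"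
    unfolding data_fit_eq quad_form_coeffs[symmetric] by (rule quad_form_cong) (simp add: w_def)
  finally show ?thesis
    using ext.data_fit_ge[of w f] by (simp add: data_fit_eq nth_append) (simp add: w_def)
qed

text \<open>Schur complement: one block elimination step makes the bordered Gram matrix block triangular.\<close>

lemma det_gram_append: "det (gram_mat k (X @ [y])) = det (gram_mat k X) * cond_var k y X"
proof -
  let ?n = "length X" and ?A = "gram_mat k X"
  define c where "c = mat ?n 1 (\<lambda>(i, j). k y (X ! i))"
  \<comment> \<open>The column \<open>u\<close> solves \<open>?A * u + c = 0\<close>, so
    multiplication by \<open>E\<close> clears the upper right block and leaves the variance in the
    corner.\<close>
  define u where "u = mat ?n 1 (\<lambda>(i, j). - coeffs (k y) i)"
  define r where "r = mat 1 ?n (\<lambda>(i, j). k y (X ! j))"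
  define d where "d = mat 1 1 (\<lambda>(i, j). k y y)"
  define M where "M = four_block_mat ?A c r d"
  define E where "E = four_block_mat (1\<^sub>m ?n) u (0\<^sub>m 1 ?n) (1\<^sub>m 1)"
  note defs = c_def u_def r_def d_def
  have A: "?A \<in> carrier_mat ?n ?n" by (rule gram_carrier)
  have carr: "c \<in> carrier_mat ?n 1" "u \<in> carrier_mat ?n 1" "r \<in> carrier_mat 1 ?n" "d \<in> carrier_mat 1 1"
    by (simp_all add: defs)
  have M: "M = gram_mat k (X @ [y])"
    using subset y by (auto simp: M_def gram_mat_def defs nth_append less_Suc_eq intro!: eq_matI sym)
  have Au: "?A * u + c = 0\<^sub>m ?n 1"
    by (rule eq_matI)
      (auto simp: gram_mat_def u_def c_def scalar_prod_def sum_negf gram_mult_coeffs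
        lessThan_atLeast0[symmetric])
  have ru: "r * u + d = mat 1 1 (\<lambda>(i, j). cond_var k y X)"
    by (rule eq_matI)
      (auto simp: r_def u_def d_def scalar_prod_def sum_negf cond_var_eq lessThan_atLeast0)
  have "M * E = four_block_mat (?A * 1\<^sub>m ?n + c * 0\<^sub>m 1 ?n) (?A * u + c * 1\<^sub>m 1)
      (r * 1\<^sub>m ?n + d * 0\<^sub>m 1 ?n) (r * u + d * 1\<^sub>m 1)"
    unfolding M_def E_def
    by (rule mult_four_block_mat[OF A carr(1,3,4) _ carr(2)]) auto
  also have "\<dots> = four_block_mat ?A (0\<^sub>m ?n 1) r (mat 1 1 (\<lambda>(i, j). cond_var k y X))"
    using A carr Au ru by simp
  finally have ME: "M * E = four_block_mat ?A (0\<^sub>m ?n 1) r (mat 1 1 (\<lambda>(i, j). cond_var k y X))" .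
  have "det M * det E = det (M * E)"
    using A carr by (intro det_mult[symmetric, of _ "?n + 1"]) (auto simp: M_def E_def)
  also have "\<dots> = det ?A * cond_var k y X"
    unfolding ME using A carr
    by (subst det_four_block_mat_upper_right_zero[of _ ?n _ 1]) (auto simp: det_single)
  also have "det E = 1"
    unfolding E_def using carr
    by (subst det_four_block_mat_lower_left_zero[of _ ?n _ 1]) auto
  finally show ?thesis by (simp add: M)
qed

end

subsection \<open>Bounds by the norm of the reproducing kernel Hilbert space\<close>

context rkhs
begin

lemma ip_add_right: "f \<in> H \<Longrightarrow> g \<in> H \<Longrightarrow> h \<in> H \<Longrightarrow> ip h (\<lambda>x. f x + g x) = ip h f + ip h g"
  using ip_add_left[of f g h] ip_commute[OF add_mem, of f g h] ip_commute[of f h] ip_commute[of g h]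
  by simp

lemma ip_scale_right: "f \<in> H \<Longrightarrow> g \<in> H \<Longrightarrow> ip g (\<lambda>x. c * f x) = c * ip g f"
  using ip_scale_left[of f g c] ip_commute[OF scale_mem, of f g c] ip_commute[of f g] by simp

lemma ip_zero_right: "g \<in> H \<Longrightarrow> ip g (\<lambda>x. 0) = 0"
  using ip_scale_right[of "\<lambda>x. 0" g 0] zero_mem by simp

lemma sum_mem: "(\<And>i. i < (n :: nat) \<Longrightarrow> g i \<in> H) \<Longrightarrow> (\<lambda>x. \<Sum>i<n. w i * g i x) \<in> H"
proof (induction n)
  case (Suc n)
  then show ?case
    using add_mem[OF _ scale_mem, of "\<lambda>x. \<Sum>i<n. w i * g i x" "g n" "w n"] by simp
qed (simp add: zero_mem)

lemma ip_sum_right: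
  assumes "h \<in> H" "\<And>i. i < (n :: nat) \<Longrightarrow> g i \<in> H"
  shows "ip h (\<lambda>x. \<Sum>i<n. w i * g i x) = (\<Sum>i<n. w i * ip h (g i))"
  using assms(2)
proof (induction n)
  case (Suc n)
  then show ?case
    using ip_add_right[OF _ scale_mem assms(1), of "\<lambda>x. \<Sum>i<n. w i * g i x" "g n" "w n"]
    by (simp add: sum_mem ip_scale_right assms(1))
qed (simp add: ip_zero_right assms(1))

text \<open>The gap is the squared norm of \<open>f - s\<close>, where \<open>s\<close> is the
  combination of kernel sections with weights \<open>w\<close>.\<close>

lemma norm_ge_linear_minus_quad:
  assumes f: "f \<in> H" and X: "set X \<subseteq> \<Omega>"
  shows "2 * (\<Sum>i<length X. w i * f (X ! i)) - quad_form k X w \<le> (rkhs_norm ip f)\<^sup>2"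
proof -
  define g where "g i = kernel_section \<Omega> k (X ! i)" for i
  define s where "s = (\<lambda>x. \<Sum>i<length X. w i * g i x)"
  have \<Omega>: "X ! i \<in> \<Omega>" if "i < length X" for i using X that by auto
  have g: "g i \<in> H" if "i < length X" for i
    using \<Omega>[OF that] by (simp add: g_def section_mem)
  have s: "s \<in> H" unfolding s_def by (rule sum_mem) (rule g)
  have eval: "ip h s = (\<Sum>i<length X. w i * h (X ! i))" if "h \<in> H" for h
    unfolding s_def using that g by (simp add: ip_sum_right) (simp add: g_def \<Omega> reproducing)
  have "ip s s = (\<Sum>i<length X. \<Sum>j<length X. w i * w j * k (X ! j) (X ! i))"
    using eval[OF s] by (simp add: s_def g_def kernel_section_def \<Omega> sum_distrib_left mult.assoc)
  also have "\<dots> = quad_form k X w"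
    unfolding quad_form_def by (subst sum.swap) (simp add: algebra_simps)
  finally have ss: "ip s s = quad_form k X w" .
  \<comment> \<open>The difference is written as a sum with a multiple of \<open>s\<close>, the form
    to which \<open>add_mem\<close> and \<open>scale_mem\<close> apply.\<close>
  have ms: "(\<lambda>x. - 1 * s x) \<in> H" by (rule scale_mem) (rule s)
  have "0 \<le> ip (\<lambda>x. f x + - 1 * s x) (\<lambda>x. f x + - 1 * s x)"
    by (intro ip_nonneg add_mem f ms)
  also have "\<dots> = ip f f - 2 * ip f s + ip s s"
    using f s ms by (simp only: ip_add_left ip_add_right add_mem ip_scale_left ip_scale_right)
      (simp add: ip_commute[OF s f])
  finally show ?thesis
    using f by (simp add: ss eval rkhs_norm_def ip_nonneg)
qed

lemma data_fit_le_norm: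
  assumes "pd_points \<Omega> k X" "f \<in> H"
  shows "data_fit k f X \<le> (rkhs_norm ip f)\<^sup>2"
proof -
  interpret pd_points \<Omega> k X by fact
  show ?thesis
    using norm_ge_linear_minus_quad[OF assms(2) subset, of "coeffs f"]
    by (simp add: quad_form_coeffs data_fit_eq)
qed

text \<open>For residual weights of scale \<open>t\<close> the general bound reads
  \<open>2 * t * e - t\<^sup>2 * V\<close>; the choice \<open>t = e / V\<close> maximises
  it.\<close>

lemma residual_le_norm:
  assumes "pd_points_extend \<Omega> k X y" "f \<in> H"
  shows "(f y - cond_mean k f y X)\<^sup>2 / cond_var k y X \<le> (rkhs_norm ip f)\<^sup>2"
proof -
  interpret pd_points_extend \<Omega> k X y by fact
  define e V where "e = f y - cond_mean k f y X" and "V = cond_var k y X"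
  have V: "0 < V" using cond_var_pos by (simp add: V_def)
  have "2 * (e / V * e) - (e / V)\<^sup>2 * V \<le> (rkhs_norm ip f)\<^sup>2"
    using norm_ge_linear_minus_quad[OF assms(2) ext.subset, of "residual_weights y (e / V)"]
    unfolding sum_residual[OF y(1)] quad_form_residual[OF y(1)] by (simp add: e_def V_def)
  moreover have "2 * (e / V * e) - (e / V)\<^sup>2 * V = e\<^sup>2 / V"
    using V by (simp add: field_simps power2_eq_square)
  ultimately show ?thesis by (simp add: e_def V_def)
qed

end

subsection \<open>Sequences of points\<close>

lemma points_Suc: "points x (Suc n) = points x n @ [x (Suc n)]"
  by (simp add: points_def)

locale pd_sequence =
  fixes \<Omega> :: "'a set" and k :: "'a \<Rightarrow> 'a \<Rightarrow> real" and x :: "nat \<Rightarrow> 'a"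
  assumes pd: "pd_kernel \<Omega> k" and range: "x ` {1..} \<subseteq> \<Omega>" and inj: "inj_on x {1..}"
begin

lemma points_pd: "pd_points \<Omega> k (points x n)"
proof
  show "set (points x n) \<subseteq> \<Omega>" using range by (auto simp: points_def)
  have "inj_on x (set [1..<Suc n])" by (rule inj_on_subset[OF inj]) auto
  then show "distinct (points x n)"
    unfolding points_def distinct_map by simp
qed (rule pd)

lemma points_extend: "pd_points_extend \<Omega> k (points x n) (x (Suc n))"
proof -
  interpret pd_points \<Omega> k "points x n" by (rule points_pd)
  interpret Suc: pd_points \<Omega> k "points x (Suc n)" by (rule points_pd)
  show ?thesis
    using Suc.subset Suc.distinct by unfold_locales (simp_all add: points_Suc)
qed

lemma points_without_extend:
  assumes "i \<in> {1..n}"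
  shows "pd_points_extend \<Omega> k (points_without x n i) (x i)"
proof -
  interpret pd_points \<Omega> k "points x n" by (rule points_pd)
  show ?thesis
    using assms subset distinct range pd
    by unfold_locales (auto simp: points_without_def distinct_removeAll)
qed

lemmas cond_var_points_pos = pd_points_extend.cond_var_pos[OF points_extend]
  and cond_var_without_pos = pd_points_extend.cond_var_pos[OF points_without_extend]

lemma det_points_Suc:
  "det (gram_mat k (points x (Suc n))) =
    det (gram_mat k (points x n)) * cond_var k (x (Suc n)) (points x n)"
  unfolding points_Suc by (rule pd_points_extend.det_gram_append[OF points_extend])

lemma det_points_pos: "0 < det (gram_mat k (points x n))"
proof (induction n)
  case 0
  show ?case by (simp add: points_def gram_mat_def)
next
  case (Suc n)
  then show ?case by (simp add: det_points_Suc cond_var_points_pos)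
qed

definition log_det :: "nat \<Rightarrow> real" where
  "log_det n = ln (det (gram_mat k (points x n)))"

lemma log_det_0: "log_det 0 = 0"
  by (simp add: log_det_def points_def gram_mat_def)

text \<open>Chain rule: the determinant is the product of the sequential conditional
  variances.\<close>

lemma log_det_Suc: "log_det (Suc n) = log_det n + ln (cond_var k (x (Suc n)) (points x n))"
  by (simp add: log_det_def det_points_Suc ln_mult_pos det_points_pos cond_var_points_pos)

lemma ml_loss_eq: "ml_loss k f x n = data_fit k f (points x n) + log_det n"
  by (simp add: ml_loss_def data_fit_def log_det_def)

lemma data_fit_points_mono:
  assumes "m \<le> n"
  shows "data_fit k f (points x m) \<le> data_fit k f (points x n)"
  using assms
proof (induction n rule: dec_induct)
  case (step n)
  then show ?case
    using pd_points_extend.data_fit_mono[OF points_extend, of f n] by (simp add: points_Suc)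
qed simp

end

section \<open>Variance ratios and uniform rates\<close>

lemma ln_ge_of_ratio_le:
  fixes u v r :: real
  assumes "0 < u" "0 < v" "u / v \<le> r"
  shows "ln u - ln r \<le> ln v"
proof -
  have "0 < u / v" using assms by simp
  then have "ln (u / v) \<le> ln r" using assms(3) by (subst ln_le_cancel_iff) auto
  then show ?thesis using assms by (simp add: ln_div)
qed

text \<open>The increments of both log determinants telescope, and each increment for
  \<open>k\<close> exceeds that for \<open>k0\<close> by at least \<open>- ln r\<close>.\<close>

lemma log_det_gap:
  assumes "pd_sequence \<Omega> k x" "pd_sequence \<Omega> k0 x" "m \<le> n"
    and ratio: "\<And>i. m < i \<Longrightarrow>
      cond_var k0 (x i) (points x (i - 1)) / cond_var k (x i) (points x (i - 1)) \<le> r"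
  shows "pd_sequence.log_det k0 x n - pd_sequence.log_det k0 x m - real (n - m) * ln r
    \<le> pd_sequence.log_det k x n - pd_sequence.log_det k x m"
proof -
  interpret k: pd_sequence \<Omega> k x by fact
  interpret k0: pd_sequence \<Omega> k0 x by fact
  show ?thesis
    using \<open>m \<le> n\<close>
  proof (induction n rule: dec_induct)
    case (step n)
    have "ln (cond_var k0 (x (Suc n)) (points x n)) - ln r \<le> ln (cond_var k (x (Suc n)) (points x n))"
      using ratio[of "Suc n"] step
      by (intro ln_ge_of_ratio_le k.cond_var_points_pos k0.cond_var_points_pos) simp
    moreover have "real (Suc n - m) * ln r = real (n - m) * ln r + ln r"
      using step by (simp add: Suc_diff_le algebra_simps)
    ultimately show ?case
      using step.IH unfolding k.log_det_Suc k0.log_det_Suc by linarith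
  qed simp
qed

lemma eventually_le_of_limsup_SUP_less:
  fixes g :: "nat \<Rightarrow> 't \<Rightarrow> real"
  assumes "limsup (\<lambda>n. SUP \<theta>\<in>\<Delta>. ereal (g n \<theta>)) < ereal a" "0 < a"
  obtains r N where "0 < r" "r < a" "\<And>n \<theta>. N \<le> n \<Longrightarrow> \<theta> \<in> \<Delta> \<Longrightarrow> g n \<theta> \<le> r"
proof -
  \<comment> \<open>The maximum with 0 makes \<open>s\<close> a positive real even if
    \<open>\<Delta>\<close> is empty and the suprema are minus infinity.\<close>
  obtain s where s: "max (limsup (\<lambda>n. SUP \<theta>\<in>\<Delta>. ereal (g n \<theta>))) 0 < s" "s < ereal a"
    using dense[of "max (limsup (\<lambda>n. SUP \<theta>\<in>\<Delta>. ereal (g n \<theta>))) 0" "ereal a"] assms by auto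
  obtain r where r: "s = ereal r" using s by (cases s) auto
  have "eventually (\<lambda>n. (SUP \<theta>\<in>\<Delta>. ereal (g n \<theta>)) < s) sequentially"
    using s(1) by (intro Limsup_lessD) simp
  then obtain N where N: "\<And>n. N \<le> n \<Longrightarrow> (SUP \<theta>\<in>\<Delta>. ereal (g n \<theta>)) < s"
    by (auto simp: eventually_sequentially)
  have "g n \<theta> \<le> r" if "N \<le> n" "\<theta> \<in> \<Delta>" for n \<theta>
    using le_less_trans[OF SUP_upper[OF that(2)] N[OF that(1)]] r by simp
  then show ?thesis using that[of r N] s r by auto
qed

subsection \<open>Comparison of the losses\<close>

text \<open>The content of the limsup hypothesis: one rate \<open>r\<close> and one index
  \<open>n0\<close> for all of \<open>\<Delta>\<close>. Ratios up to \<open>n0\<close> stay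
  uncontrolled, so a lower bound on the loss at a starting index must come from elsewhere.\<close>

locale likelihood_gap =
  rkhs \<Omega> "K \<theta>0" H ip
  for \<Omega> :: "'a set" and K :: "'t \<Rightarrow> 'a \<Rightarrow> 'a \<Rightarrow> real" and \<theta>0 H ip +
  fixes \<Delta> :: "'t set" and x :: "nat \<Rightarrow> 'a" and r :: real and n0 :: nat
  assumes seq: "\<And>\<theta>. \<theta> \<in> insert \<theta>0 \<Delta> \<Longrightarrow> pd_sequence \<Omega> (K \<theta>) x"
    and r: "0 < r" "r < 1"
    and ratio: "\<And>n \<theta>. n0 < n \<Longrightarrow> \<theta> \<in> \<Delta> \<Longrightarrow>
      cond_var (K \<theta>0) (x n) (points x (n - 1)) / cond_var (K \<theta>) (x n) (points x (n - 1)) \<le> r"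
begin

text \<open>
  Every step beyond \<open>n1\<close> raises the loss of \<open>\<theta>\<close> by at least \<open>- ln r\<close> more than the
  log determinant of \<open>\<theta>0\<close>, and the data fit of \<open>\<theta>0\<close> never exceeds \<open>C\<^sup>2\<close>.
\<close>

lemma ml_loss_eventually_less:
  assumes "n0 \<le> n1" and F: "F \<subseteq> H" "\<And>f. f \<in> F \<Longrightarrow> rkhs_norm ip f \<le> C"
    and lower: "\<And>f \<theta>. f \<in> F \<Longrightarrow> \<theta> \<in> \<Delta> \<Longrightarrow> m \<le> ml_loss (K \<theta>) f x n1"
  shows "\<exists>N. \<forall>f\<in>F. \<forall>n\<ge>N. \<forall>\<theta>\<in>\<Delta>. ml_loss (K \<theta>0) f x n < ml_loss (K \<theta>) f x n"
proof -
  interpret k0: pd_sequence \<Omega> "K \<theta>0" x by (rule seq) simp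
  \<comment> \<open>After \<open>p\<close> steps the gain outweighs all constants. Since
    \<open>p\<close> involves neither \<open>f\<close> nor \<open>\<theta>\<close>, the threshold
    \<open>n1 + p\<close> is uniform.\<close>
  obtain p where p: "C\<^sup>2 + k0.log_det n1 - m < real p * (- ln r)"
    using reals_Archimedean3[of "- ln r"] r by auto
  have "ml_loss (K \<theta>0) f x n < ml_loss (K \<theta>) f x n"
    if f: "f \<in> F" and n: "n1 + p \<le> n" and \<theta>: "\<theta> \<in> \<Delta>" for f n \<theta>
  proof -
    interpret k: pd_sequence \<Omega> "K \<theta>" x by (rule seq) (simp add: \<theta>)
    have "real p * (- ln r) \<le> real (n - n1) * (- ln r)"
      using n r by (intro mult_right_mono) auto
    moreover have "k0.log_det n - k0.log_det n1 - real (n - n1) * ln r \<le> k.log_det n - k.log_det n1"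
      using n \<theta> \<open>n0 \<le> n1\<close> by (intro log_det_gap[OF k.pd_sequence_axioms k0.pd_sequence_axioms] ratio) auto
    moreover have "data_fit (K \<theta>) f (points x n1) \<le> data_fit (K \<theta>) f (points x n)"
      using n by (intro k.data_fit_points_mono) simp
    moreover have "m \<le> data_fit (K \<theta>) f (points x n1) + k.log_det n1"
      using lower[OF f \<theta>] by (simp add: k.ml_loss_eq)
    moreover have "data_fit (K \<theta>0) f (points x n) \<le> (rkhs_norm ip f)\<^sup>2"
      using f F by (intro data_fit_le_norm k0.points_pd) auto
    moreover have "(rkhs_norm ip f)\<^sup>2 \<le> C\<^sup>2"
      using f F by (intro power_mono) (auto simp: rkhs_norm_def ip_nonneg subset_eq)
    ultimately show ?thesis
      using p unfolding k.ml_loss_eq k0.ml_loss_eq by linarith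
  qed
  then show ?thesis by blast
qed

text \<open>At each step a finite supremum \<open>R\<close> of the ratios keeps the variance of
  \<open>\<theta>\<close> above a fixed fraction of that of \<open>\<theta>0\<close>.\<close>

lemma log_det_bounded_below:
  assumes "\<And>n. 1 \<le> n \<Longrightarrow> (SUP \<theta>\<in>\<Delta>. ereal (cond_var (K \<theta>0) (x n) (points x (n - 1))
                                  / cond_var (K \<theta>) (x n) (points x (n - 1)))) < \<infinity>"
  shows "\<exists>m. \<forall>\<theta>\<in>\<Delta>. m \<le> pd_sequence.log_det (K \<theta>) x n"
proof (induction n)
  case 0
  show ?case
    using pd_sequence.log_det_0[OF seq] by (intro exI[of _ 0]) simp
next
  case (Suc n)
  then obtain m where m: "\<And>\<theta>. \<theta> \<in> \<Delta> \<Longrightarrow> m \<le> pd_sequence.log_det (K \<theta>) x n" by blast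
  interpret k0: pd_sequence \<Omega> "K \<theta>0" x by (rule seq) simp
  let ?q = "\<lambda>\<theta>. cond_var (K \<theta>0) (x (Suc n)) (points x n) / cond_var (K \<theta>) (x (Suc n)) (points x n)"
  have "(SUP \<theta>\<in>\<Delta>. ereal (?q \<theta>)) < \<infinity>" using assms[of "Suc n"] by simp
  then obtain R where R: "(SUP \<theta>\<in>\<Delta>. ereal (?q \<theta>)) < ereal R"
    using less_PInf_Ex_of_nat by (metis ereal_dense2)
  have "m + (ln (cond_var (K \<theta>0) (x (Suc n)) (points x n)) - ln R)
      \<le> pd_sequence.log_det (K \<theta>) x (Suc n)" if \<theta>: "\<theta> \<in> \<Delta>" for \<theta>
  proof -
    interpret k: pd_sequence \<Omega> "K \<theta>" x by (rule seq) (simp add: \<theta>)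
    have "?q \<theta> \<le> R"
      using le_less_trans[OF SUP_upper[OF \<theta>] R] by simp
    then have "ln (cond_var (K \<theta>0) (x (Suc n)) (points x n)) - ln R
        \<le> ln (cond_var (K \<theta>) (x (Suc n)) (points x n))"
      by (intro ln_ge_of_ratio_le k.cond_var_points_pos k0.cond_var_points_pos)
    then show ?thesis using m[OF \<theta>] by (simp add: k.log_det_Suc)
  qed
  then show ?case by blast
qed

text \<open>If no estimate exists from \<open>n0\<close> on, the claim is vacuous. Otherwise the
  minimal loss at one such index bounds the loss over \<open>\<Delta>\<close> from below; this
  bound, and hence \<open>N\<close>, may depend on \<open>f\<close>.\<close>

lemma ml_estimate_avoids:
  assumes "\<Delta> \<subseteq> \<Theta>" "\<theta>0 \<in> \<Theta>" "f \<in> H"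
  shows "\<exists>N. \<forall>n\<ge>N. \<forall>\<theta>. ml_estimate \<Theta> K f x n \<theta> \<longrightarrow> \<theta> \<notin> \<Delta>"
proof (cases "\<exists>n1\<ge>n0. \<exists>\<theta>. ml_estimate \<Theta> K f x n1 \<theta>")
  case True
  then obtain n1 \<theta>1 where "n0 \<le> n1" "ml_estimate \<Theta> K f x n1 \<theta>1" by blast
  then have "\<exists>N. \<forall>f\<in>{f}. \<forall>n\<ge>N. \<forall>\<theta>\<in>\<Delta>. ml_loss (K \<theta>0) f x n < ml_loss (K \<theta>) f x n"
    using assms
    by (intro ml_loss_eventually_less[where C = "rkhs_norm ip f" and m = "ml_loss (K \<theta>1) f x n1"])
      (auto simp: ml_estimate_def is_arg_min_def not_less)
  \<comment> \<open>A minimiser over \<open>\<Theta>\<close> cannot have a larger loss than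
    \<open>\<theta>0\<close>.\<close>
  then show ?thesis
    using assms(2) by (fastforce simp: ml_estimate_def is_arg_min_def)
qed auto

lemma ml_estimate_avoids_uniformly:
  assumes "\<Delta> \<subseteq> \<Theta>" "\<theta>0 \<in> \<Theta>" "F \<subseteq> H" "rkhs_bounded ip F" "ml_well_posed \<Theta> \<Delta> \<theta>0 K x"
  shows "\<exists>N. \<forall>f\<in>F. \<forall>n\<ge>N. \<forall>\<theta>. ml_estimate \<Theta> K f x n \<theta> \<longrightarrow> \<theta> \<notin> \<Delta>"
proof -
  \<comment> \<open>The start is \<open>Suc n0\<close> because well-posedness speaks of indices from
    1 on. A bound on the log determinant serves every \<open>f\<close>, as the data fit is
    nonnegative.\<close>
  have "\<exists>m. \<forall>\<theta>\<in>\<Delta>. m \<le> pd_sequence.log_det (K \<theta>) x (Suc n0)"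
    using assms(5) unfolding ml_well_posed_def
  proof
    assume "\<forall>f. \<forall>n\<ge>1. \<exists>\<theta>. ml_estimate \<Theta> K f x n \<theta>"
    then obtain \<theta>1 where \<theta>1: "ml_estimate \<Theta> K (\<lambda>_. 0) x (Suc n0) \<theta>1"
      by (metis le_add1 plus_1_eq_Suc)
    have "ml_loss (K \<theta>1) (\<lambda>_. 0) x (Suc n0) \<le> pd_sequence.log_det (K \<theta>) x (Suc n0)"
      if \<theta>: "\<theta> \<in> \<Delta>" for \<theta>
    proof -
      interpret k: pd_sequence \<Omega> "K \<theta>" x by (rule seq) (simp add: \<theta>)
      have "ml_loss (K \<theta>1) (\<lambda>_. 0) x (Suc n0) \<le> ml_loss (K \<theta>) (\<lambda>_. 0) x (Suc n0)"
        using \<theta>1 \<theta> assms(1) by (auto simp: ml_estimate_def is_arg_min_def not_less)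
      then show ?thesis
        by (simp add: k.ml_loss_eq pd_points.data_fit_zero[OF k.points_pd])
    qed
    then show ?thesis by blast
  qed (use log_det_bounded_below in blast)
  then obtain m where m: "\<And>\<theta>. \<theta> \<in> \<Delta> \<Longrightarrow> m \<le> pd_sequence.log_det (K \<theta>) x (Suc n0)" by blast
  have "m \<le> ml_loss (K \<theta>) f x (Suc n0)" if \<theta>: "\<theta> \<in> \<Delta>" for f \<theta>
  proof -
    interpret k: pd_sequence \<Omega> "K \<theta>" x by (rule seq) (simp add: \<theta>)
    show ?thesis
      using m[OF \<theta>] pd_points.data_fit_nonneg[OF k.points_pd, of f "Suc n0"]
      by (simp add: k.ml_loss_eq)
  qed
  moreover obtain C where "\<And>f. f \<in> F \<Longrightarrow> rkhs_norm ip f \<le> C"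
    using assms(4) by (auto simp: rkhs_bounded_def)
  ultimately have "\<exists>N. \<forall>f\<in>F. \<forall>n\<ge>N. \<forall>\<theta>\<in>\<Delta>. ml_loss (K \<theta>0) f x n < ml_loss (K \<theta>) f x n"
    using assms(3) by (intro ml_loss_eventually_less[of "Suc n0"]) auto
  then show ?thesis
    using assms(2) by (fastforce simp: ml_estimate_def is_arg_min_def)
qed

end

section \<open>Comparison of the cross-validation losses\<close>

text \<open>In each summand the residual term of \<open>k\<close> costs at most
  \<open>b\<^sup>2\<close>, while the logarithm for \<open>k1\<close> gains at least
  \<open>- ln r\<close>, which is larger than \<open>b\<^sup>2\<close>.\<close>

lemma (in rkhs) cv_loss_less:
  assumes "pd_sequence \<Omega> k x" "pd_sequence \<Omega> k1 x" "1 \<le> n"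
    and f: "f \<in> H" "rkhs_norm ip f \<le> b"
    and r: "0 < r" "r < exp (- b\<^sup>2)"
    and ratio: "\<And>i. i \<in> {1..n} \<Longrightarrow>
      cond_var k (x i) (points_without x n i) / cond_var k1 (x i) (points_without x n i) \<le> r"
  shows "cv_loss k f x n < cv_loss k1 f x n"
  unfolding cv_loss_def
proof (rule sum_strict_mono)
  fix i assume i: "i \<in> {1..n}"
  interpret k: pd_sequence \<Omega> k x by fact
  interpret k1: pd_sequence \<Omega> k1 x by fact
  let ?X = "points_without x n i"
  note pos = k.cond_var_without_pos[OF i] k1.cond_var_without_pos[OF i]
  have "ln r < - b\<^sup>2" using r by (metis ln_exp ln_less_cancel_iff exp_gt_zero)
  moreover have "(f (x i) - cond_mean k f (x i) ?X)\<^sup>2 / cond_var k (x i) ?X \<le> (rkhs_norm ip f)\<^sup>2"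
    using k.points_without_extend[OF i] f(1) by (rule residual_le_norm)
  moreover have "(rkhs_norm ip f)\<^sup>2 \<le> b\<^sup>2"
    using f by (intro power_mono) (auto simp: rkhs_norm_def ip_nonneg)
  moreover have "ln (cond_var k (x i) ?X) - ln r \<le> ln (cond_var k1 (x i) ?X)"
    using pos ratio[OF i] by (rule ln_ge_of_ratio_le)
  moreover have "0 \<le> (f (x i) - cond_mean k1 f (x i) ?X)\<^sup>2 / cond_var k1 (x i) ?X"
    using pos by simp
  ultimately show "(f (x i) - cond_mean k f (x i) ?X)\<^sup>2 / cond_var k (x i) ?X + ln (cond_var k (x i) ?X)
      < (f (x i) - cond_mean k1 f (x i) ?X)\<^sup>2 / cond_var k1 (x i) ?X + ln (cond_var k1 (x i) ?X)"
    by linarith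
qed (use assms(3) in auto)

theorem theorem2p7:
  fixes \<Omega> :: "'a set"
    and \<Theta> \<Delta> :: "'t set"
    and \<theta>0 :: 't
    and K :: "'t \<Rightarrow> 'a \<Rightarrow> 'a \<Rightarrow> real"
    and x :: "nat \<Rightarrow> 'a"
    and H B :: "('a \<Rightarrow> real) set"
    and ip :: "('a \<Rightarrow> real) \<Rightarrow> ('a \<Rightarrow> real) \<Rightarrow> real"
    and b :: real
  assumes "infinite \<Omega>"
    and "\<And>\<theta>. \<theta> \<in> \<Theta> \<Longrightarrow> pd_kernel \<Omega> (K \<theta>)"
    and "x ` {1..} \<subseteq> \<Omega>" and "inj_on x {1..}"
    and "\<Delta> \<subseteq> \<Theta>" and "\<theta>0 \<in> \<Theta>"
    and "rkhs \<Omega> (K \<theta>0) H ip"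
    and "B \<subseteq> H" and "rkhs_bounded ip B"
    and "b = (SUP f\<in>B. rkhs_norm ip f)"
  shows
    "(limsup (\<lambda>n. SUP \<theta>\<in>\<Delta>. ereal (cond_var (K \<theta>0) (x n) (points x (n - 1))
                                    / cond_var (K \<theta>) (x n) (points x (n - 1)))) < 1
      \<longrightarrow> (ml_well_posed \<Theta> \<Delta> \<theta>0 K x \<longrightarrow>
             (\<exists>N. \<forall>f0\<in>B. \<forall>n\<ge>N. \<forall>\<theta>. ml_estimate \<Theta> K f0 x n \<theta> \<longrightarrow> \<theta> \<notin> \<Delta>)) \<and>
          (\<forall>f0\<in>B. \<exists>N. \<forall>n\<ge>N. \<forall>\<theta>. ml_estimate \<Theta> K f0 x n \<theta> \<longrightarrow> \<theta> \<notin> \<Delta>))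
     \<and>
     (limsup (\<lambda>n. SUP \<theta>\<in>\<Delta>. ereal (MAX i\<in>{1..n}.
                     cond_var (K \<theta>0) (x i) (points_without x n i)
                     / cond_var (K \<theta>) (x i) (points_without x n i))) < ereal (exp (- b\<^sup>2))
      \<longrightarrow> (\<exists>N. \<forall>f0\<in>B. \<forall>n\<ge>N. \<forall>\<theta>. cv_estimate \<Theta> K f0 x n \<theta> \<longrightarrow> \<theta> \<notin> \<Delta>))"
proof (intro conjI impI)
  interpret rkhs \<Omega> "K \<theta>0" H ip by fact
  have seq: "pd_sequence \<Omega> (K \<theta>) x" if "\<theta> \<in> \<Theta>" for \<theta>
    using assms(2)[OF that] assms(3,4) by unfold_locales
  {
    assume "limsup (\<lambda>n. SUP \<theta>\<in>\<Delta>. ereal (cond_var (K \<theta>0) (x n) (points x (n - 1))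
                                    / cond_var (K \<theta>) (x n) (points x (n - 1)))) < 1"
    \<comment> \<open>The supremum lies inside the limsup, so \<open>r\<close> and \<open>n0\<close>
      do not depend on \<open>\<theta>\<close>.\<close>
    then obtain r n0 where r: "0 < r" "r < 1" "\<And>n \<theta>. n0 \<le> n \<Longrightarrow> \<theta> \<in> \<Delta> \<Longrightarrow>
        cond_var (K \<theta>0) (x n) (points x (n - 1)) / cond_var (K \<theta>) (x n) (points x (n - 1)) \<le> r"
      unfolding one_ereal_def by (rule eventually_le_of_limsup_SUP_less) auto
    interpret likelihood_gap \<Omega> K \<theta>0 H ip \<Delta> x r n0
      using assms(5,6) r seq rkhs_axioms
      by (intro likelihood_gap.intro likelihood_gap_axioms.intro) auto
    show "\<forall>f0\<in>B. \<exists>N. \<forall>n\<ge>N. \<forall>\<theta>. ml_estimate \<Theta> K f0 x n \<theta> \<longrightarrow> \<theta> \<notin> \<Delta>"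
      using ml_estimate_avoids[OF assms(5,6)] assms(8) by blast
    show "\<exists>N. \<forall>f0\<in>B. \<forall>n\<ge>N. \<forall>\<theta>. ml_estimate \<Theta> K f0 x n \<theta> \<longrightarrow> \<theta> \<notin> \<Delta>"
      if "ml_well_posed \<Theta> \<Delta> \<theta>0 K x"
      using ml_estimate_avoids_uniformly[OF assms(5,6,8,9) that] .
  }
  assume "limsup (\<lambda>n. SUP \<theta>\<in>\<Delta>. ereal (MAX i\<in>{1..n}.
                     cond_var (K \<theta>0) (x i) (points_without x n i)
                     / cond_var (K \<theta>) (x i) (points_without x n i))) < ereal (exp (- b\<^sup>2))"
  then obtain r N where r: "0 < r" "r < exp (- b\<^sup>2)" and N: "\<And>n \<theta>. N \<le> n \<Longrightarrow> \<theta> \<in> \<Delta> \<Longrightarrow>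
      (MAX i\<in>{1..n}. cond_var (K \<theta>0) (x i) (points_without x n i)
                     / cond_var (K \<theta>) (x i) (points_without x n i)) \<le> r"
    by (rule eventually_le_of_limsup_SUP_less) auto
  \<comment> \<open>At \<open>n = 0\<close> both losses are empty sums and the strict inequality
    fails, hence \<open>max 1 N\<close>.\<close>
  have "cv_loss (K \<theta>0) f x n < cv_loss (K \<theta>) f x n"
    if f: "f \<in> B" and n: "max 1 N \<le> n" and \<theta>: "\<theta> \<in> \<Delta>" for f n \<theta>
  proof (rule cv_loss_less[OF seq seq _ _ _ r])
    \<comment> \<open>A real supremum is known to be an upper bound only for a set that is bounded
      above.\<close>
    have "bdd_above (rkhs_norm ip ` B)"
      using assms(9) by (auto simp: rkhs_bounded_def bdd_above_def)
    then show "rkhs_norm ip f \<le> b"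
      unfolding assms(10) using f by (intro cSUP_upper)
    show "cond_var (K \<theta>0) (x i) (points_without x n i) / cond_var (K \<theta>) (x i) (points_without x n i) \<le> r"
      if "i \<in> {1..n}" for i
      using N[of n \<theta>] n \<theta> that by (intro order_trans[OF Max_ge N]) auto
  qed (use f n \<theta> assms in auto)
  then show "\<exists>N. \<forall>f0\<in>B. \<forall>n\<ge>N. \<forall>\<theta>. cv_estimate \<Theta> K f0 x n \<theta> \<longrightarrow> \<theta> \<notin> \<Delta>"
    using assms(6) by (intro exI[of _ "max 1 N"]) (fastforce simp: cv_estimate_def is_arg_min_def)
qed

end
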